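(* Let $m\ge 2$, let $\mathcal{P}$ be an order-$m$, $n$-dimensional stochastic tensor, let $v$ and $x_0$ be stochastic vectors in $\mathbb{R}^n$, let $0\le\alpha<1/(m-1)$, and let $\gamma\ge 0$. Then the shifted fixed-point iteration $$x_{k+1}=\frac{\alpha}{1+\gamma}\,\mathcal{P}x_k^{m-1}+\frac{1-\alpha}{1+\gamma}\,v+\frac{\gamma}{1+\gamma}\,x_k$$ converges to the unique solution $x$ of the multilinear PageRank problem $(\alpha,\mathcal{P},v)$, and for all $k\ge 0$ $$\|x_k-x\|_1\le\left(\frac{\alpha(m-1)+\gamma}{1+\gamma}\right)^k\|x_0-x\|_1\le 2\left(\frac{\alpha(m-1)+\gamma}{1+\gamma}\right)^k .$$
   Context: A vector is stochastic if its entries are nonnegative and sum to $1$. An order-$m$, $n$-dimensional tensor is an array with $m$ indices, each ranging over $1,\dots,n$; it is stochastic if its entries are nonnegative and, for every fixed choice of the last $m-1$ indices, the sum over the first index equals $1$. For $x\in\mathbb{R}^n$, $[\mathcal{P}x^{m-1}]_i=\sum_{i_2,\dots,i_m}\mathcal{P}(i,i_2,\dots,i_m)\,x_{i_2}\cdots x_{i_m}$. A solution of the multilinear PageRank problem $(\alpha,\mathcal{P},v)$ is a stochastic vector $x$ with $x=\alpha\,\mathcal{P}x^{m-1}+(1-\alpha)v$; for $\alpha<1/(m-1)$ it exists and is unique. *)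

theory Defs
  imports "HOL-Analysis.Analysis"
begin

definition stochastic_vector :: "real ^ 'n::finite \<Rightarrow> bool" where
  "stochastic_vector x \<longleftrightarrow> (\<forall>i. 0 \<le> x $ i) \<and> (\<Sum>i\<in>UNIV. x $ i) = 1"

definition l1_norm :: "real ^ 'n::finite \<Rightarrow> real" where
  "l1_norm x = (\<Sum>i\<in>UNIV. \<bar>x $ i\<bar>)"

(* The order m is a natural number, so an order-m tensor over the index type 'n is given by
   its entries P [i_1, ..., i_m]; values of P at lists whose length is not m are irrelevant. *)
type_synonym 'n tensor = "'n list \<Rightarrow> real"

definition stochastic_tensor :: "nat \<Rightarrow> 'n::finite tensor \<Rightarrow> bool" where
  "stochastic_tensor m P \<longleftrightarrow>
     (\<forall>is. length is = m \<longrightarrow> 0 \<le> P is) \<and>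
     (\<forall>js. length js = m - 1 \<longrightarrow> (\<Sum>i\<in>UNIV. P (i # js)) = 1)"

(* The vector P x^(m-1); the list js is the multi-index (i_2, ..., i_m). *)
definition tensor_apply :: "nat \<Rightarrow> 'n::finite tensor \<Rightarrow> real ^ 'n \<Rightarrow> real ^ 'n" where
  "tensor_apply m P x =
     (\<chi> i. \<Sum>js | length js = m - 1. P (i # js) * (\<Prod>j\<leftarrow>js. x $ j))"

definition multilinear_pagerank_solution ::
    "nat \<Rightarrow> real \<Rightarrow> 'n::finite tensor \<Rightarrow> real ^ 'n \<Rightarrow> real ^ 'n \<Rightarrow> bool" where
  "multilinear_pagerank_solution m \<alpha> P v x \<longleftrightarrow>
     stochastic_vector x \<and> x = \<alpha> *\<^sub>R tensor_apply m P x + (1 - \<alpha>) *\<^sub>R v"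

end

theory Submission
  imports Defs
begin

text \<open>
  The iteration applies a map that sends the probability simplex into itself and contracts the
  1-norm there, so everything follows from one Lipschitz estimate.

  A stochastic vector \<open>x\<close> defines a probability distribution on the words \<open>js\<close> of length \<open>r\<close>, with
  weight \<open>\<Prod>j\<leftarrow>js. x $ j\<close>.  Replacing \<open>x\<close> by \<open>y\<close> one letter at a time moves this distribution by at
  most \<open>\<parallel>x - y\<parallel>\<^sub>1\<close> per letter, hence by at most \<open>r \<parallel>x - y\<parallel>\<^sub>1\<close> in total
  (\<open>sum_abs_word_weight_diff_le\<close>).  A stochastic tensor is a Markov kernel from words of length
  \<open>m - 1\<close> to indices, and such a kernel does not increase 1-norms.  So \<open>x \<mapsto> P x\<^sup>m\<^sup>-\<^sup>1\<close> is Lipschitz with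
  constant \<open>m - 1\<close> on the simplex (\<open>l1_norm_tensor_apply_diff_le\<close>), and the shifted map, a convex
  combination of this map, a constant and the identity, is Lipschitz with constant
  \<open>(\<alpha> (m - 1) + \<gamma>) / (1 + \<gamma>)\<close>, which is below 1 exactly because \<open>\<alpha> (m - 1) < 1\<close>.

  The fixed points of the shifted map do not depend on \<open>\<gamma>\<close>: in the simplex they are the solutions of
  the PageRank problem.  Brouwer's theorem on the simplex gives one, the contraction
  shows that there is no other, and iterating the contraction towards the fixed point gives the
  geometric rate.
\<close>

section \<open>The 1-norm\<close>

lemma l1_norm_nonneg: "0 \<le> l1_norm x"
  by (simp add: l1_norm_def sum_nonneg)

lemma norm_le_l1_norm: "norm x \<le> l1_norm x"
  unfolding l1_norm_def by (rule norm_le_l1_cart)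

lemma l1_norm_eq_0_iff: "l1_norm x = 0 \<longleftrightarrow> x = 0"
  by (simp add: l1_norm_def sum_nonneg_eq_0_iff vec_eq_iff)

lemma l1_norm_triangle: "l1_norm (x + y) \<le> l1_norm x + l1_norm y"
  by (simp add: l1_norm_def sum.distrib[symmetric] sum_mono abs_triangle_ineq)

lemma l1_norm_scaleR: "l1_norm (c *\<^sub>R x) = \<bar>c\<bar> * l1_norm x"
  by (simp add: l1_norm_def abs_mult sum_distrib_left)

lemma l1_norm_stochastic: "stochastic_vector x \<Longrightarrow> l1_norm x = 1"
  by (simp add: stochastic_vector_def l1_norm_def)

lemma l1_norm_stochastic_diff_le:
  assumes "stochastic_vector x" "stochastic_vector y"
  shows "l1_norm (x - y) \<le> 2"
  using l1_norm_triangle[of x "(-1) *\<^sub>R y"] assms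
  by (simp add: l1_norm_scaleR[of "-1" y, simplified] l1_norm_stochastic)

section \<open>The probability simplex\<close>

lemma convex_stochastic: "convex {x :: real ^ 'n::finite. stochastic_vector x}"
  unfolding convex_def
  by (auto simp: stochastic_vector_def sum.distrib sum_distrib_left[symmetric])

lemma compact_stochastic: "compact {x :: real ^ 'n::finite. stochastic_vector x}"
proof -
  have "norm x \<le> 1" if "stochastic_vector x" for x :: "real ^ 'n"
    using norm_le_l1_norm[of x] l1_norm_stochastic[OF that] by simp
  then have "bounded {x :: real ^ 'n. stochastic_vector x}"
    by (auto simp: bounded_iff)
  moreover have "closed {x :: real ^ 'n. stochastic_vector x}"
    unfolding stochastic_vector_def
    by (intro closed_Collect_conj closed_Collect_all closed_Collect_le closed_Collect_eq
        continuous_intros)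
  ultimately show ?thesis
    by (simp add: compact_eq_bounded_closed)
qed

section \<open>Product distributions on words\<close>

lemma finite_words: "finite {js :: 'a::finite list. length js = r}"
  using finite_lists_length_eq[of "UNIV :: 'a set" r] by simp

lemma sum_words_Suc:
  fixes f :: "'a::finite list \<Rightarrow> 'b::comm_monoid_add"
  shows "(\<Sum>js | length js = Suc r. f js) = (\<Sum>j\<in>UNIV. \<Sum>ks | length ks = r. f (j # ks))"
proof -
  have "(\<Sum>js | length js = Suc r. f js)
      = (\<Sum>(j, ks) \<in> UNIV \<times> {ks. length ks = r}. f (j # ks))"
    by (rule sum.reindex_bij_witness[of _ "\<lambda>(j, ks). j # ks" "\<lambda>js. (hd js, tl js)"])
      (auto simp: length_Suc_conv)
  then show ?thesis
    by (simp add: sum.cartesian_product)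
qed

lemma prod_list_stochastic_nonneg:
  "stochastic_vector x \<Longrightarrow> 0 \<le> (\<Prod>j\<leftarrow>js. x $ j)"
  by (induction js) (auto simp: stochastic_vector_def)

lemma sum_word_weights:
  "stochastic_vector x \<Longrightarrow> (\<Sum>js | length js = r. \<Prod>j\<leftarrow>js. x $ j) = 1"
  by (induction r)
    (simp_all add: sum_words_Suc sum_distrib_left[symmetric] stochastic_vector_def)

text \<open>
  In the induction step the first letter is exchanged by
  \<open>a X - b Y = (a - b) X + b (X - Y)\<close>, where \<open>X\<close> and \<open>Y\<close> are the weights of the rest of the word.
  The two terms decouple when summed, since both \<open>X\<close> and \<open>b\<close> have total mass 1.
\<close>
lemma sum_abs_word_weight_diff_le:
  fixes x y :: "real ^ 'n::finite"
  assumes x: "stochastic_vector x" and y: "stochastic_vector y"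
  shows "(\<Sum>js | length js = r. \<bar>(\<Prod>j\<leftarrow>js. x $ j) - (\<Prod>j\<leftarrow>js. y $ j)\<bar>) \<le> real r * l1_norm (x - y)"
proof (induction r)
  case 0
  then show ?case by simp
next
  case (Suc r)
  let ?X = "\<lambda>js. \<Prod>j\<leftarrow>js. x $ j" and ?Y = "\<lambda>js. \<Prod>j\<leftarrow>js. y $ j"
  have letter: "\<bar>x $ j * ?X ks - y $ j * ?Y ks\<bar>
      \<le> \<bar>x $ j - y $ j\<bar> * ?X ks + y $ j * \<bar>?X ks - ?Y ks\<bar>" for j ks
  proof -
    have "x $ j * ?X ks - y $ j * ?Y ks = (x $ j - y $ j) * ?X ks + y $ j * (?X ks - ?Y ks)"
      by (simp add: algebra_simps)
    then show ?thesis
      using abs_triangle_ineq[of "(x $ j - y $ j) * ?X ks" "y $ j * (?X ks - ?Y ks)"]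
        prod_list_stochastic_nonneg[OF x, of ks] y
      by (simp add: abs_mult stochastic_vector_def)
  qed
  have "(\<Sum>js | length js = Suc r. \<bar>?X js - ?Y js\<bar>)
      \<le> (\<Sum>j\<in>UNIV. \<Sum>ks | length ks = r.
            \<bar>x $ j - y $ j\<bar> * ?X ks + y $ j * \<bar>?X ks - ?Y ks\<bar>)"
    by (simp add: sum_words_Suc) (intro sum_mono letter)
  also have "\<dots> = l1_norm (x - y) + (\<Sum>ks | length ks = r. \<bar>?X ks - ?Y ks\<bar>)"
    using y sum_word_weights[OF x, of r]
    by (simp add: sum.distrib sum_distrib_left[symmetric] sum_distrib_right[symmetric]
        l1_norm_def stochastic_vector_def)
  also have "\<dots> \<le> real (Suc r) * l1_norm (x - y)"
    using Suc by (simp add: algebra_simps)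
  finally show ?case .
qed

section \<open>Applying a stochastic tensor\<close>

lemma stochastic_tensor_apply:
  fixes P :: "'n::finite tensor"
  assumes "m \<ge> 1" and P: "stochastic_tensor m P" and x: "stochastic_vector x"
  shows "stochastic_vector (tensor_apply m P x)"
proof -
  have "0 \<le> tensor_apply m P x $ i" for i
    using assms(1) P
    by (auto simp: tensor_apply_def stochastic_tensor_def
        intro!: sum_nonneg mult_nonneg_nonneg prod_list_stochastic_nonneg[OF x])
  moreover have "(\<Sum>i\<in>UNIV. tensor_apply m P x $ i)
      = (\<Sum>js | length js = m - 1. (\<Sum>i\<in>UNIV. P (i # js)) * (\<Prod>j\<leftarrow>js. x $ j))"
    unfolding tensor_apply_def vec_lambda_beta sum_distrib_right by (rule sum.swap)
  moreover have "\<dots> = (\<Sum>js :: 'n list | length js = m - 1. \<Prod>j\<leftarrow>js. x $ j)"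
    using P by (intro sum.cong) (auto simp: stochastic_tensor_def)
  ultimately show ?thesis
    using sum_word_weights[OF x] by (simp add: stochastic_vector_def)
qed

lemma l1_norm_tensor_apply_diff_le:
  fixes P :: "'n::finite tensor"
  assumes "m \<ge> 1" and P: "stochastic_tensor m P"
    and x: "stochastic_vector x" and y: "stochastic_vector y"
  shows "l1_norm (tensor_apply m P x - tensor_apply m P y) \<le> (real m - 1) * l1_norm (x - y)"
proof -
  let ?D = "\<lambda>js. (\<Prod>j\<leftarrow>js. x $ j) - (\<Prod>j\<leftarrow>js. y $ j)"
  have "l1_norm (tensor_apply m P x - tensor_apply m P y)
      = (\<Sum>i\<in>UNIV. \<bar>\<Sum>js | length js = m - 1. P (i # js) * ?D js\<bar>)"
    by (simp add: l1_norm_def tensor_apply_def sum_subtractf[symmetric] right_diff_distrib)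
  also have "\<dots> \<le> (\<Sum>i\<in>UNIV. \<Sum>js | length js = m - 1. P (i # js) * \<bar>?D js\<bar>)"
  proof (intro sum_mono order.trans[OF sum_abs] eq_refl)
    fix i js
    assume "js \<in> {js :: 'n list. length js = m - 1}"
    then have "0 \<le> P (i # js)"
      using assms(1) P by (simp add: stochastic_tensor_def)
    then show "\<bar>P (i # js) * ?D js\<bar> = P (i # js) * \<bar>?D js\<bar>"
      by (simp add: abs_mult)
  qed
  also have "\<dots> = (\<Sum>js | length js = m - 1. (\<Sum>i\<in>UNIV. P (i # js)) * \<bar>?D js\<bar>)"
    unfolding sum_distrib_right by (rule sum.swap)
  also have "\<dots> = (\<Sum>js | length js = m - 1. \<bar>?D js\<bar>)"
    using P by (intro sum.cong) (auto simp: stochastic_tensor_def)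
  also have "\<dots> \<le> real (m - 1) * l1_norm (x - y)"
    by (rule sum_abs_word_weight_diff_le[OF x y])
  finally show ?thesis
    using assms(1) by (simp add: of_nat_diff)
qed

lemma continuous_on_prod_list:
  fixes f :: "'a \<Rightarrow> 'b::topological_space \<Rightarrow> 'c::{topological_semigroup_mult, monoid_mult}"
  assumes "\<And>j. continuous_on S (f j)"
  shows "continuous_on S (\<lambda>x. \<Prod>j\<leftarrow>js. f j x)"
  by (induction js) (auto intro!: continuous_intros assms)

lemma continuous_on_tensor_apply: "continuous_on S (tensor_apply m P)"
  unfolding tensor_apply_def by (intro continuous_intros continuous_on_prod_list)

section \<open>The shifted map\<close>

definition shifted_map ::
    "nat \<Rightarrow> real \<Rightarrow> real \<Rightarrow> 'n::finite tensor \<Rightarrow> real ^ 'n \<Rightarrow> real ^ 'n \<Rightarrow> real ^ 'n" where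
  "shifted_map m \<alpha> \<gamma> P v x =
     (\<alpha> / (1 + \<gamma>)) *\<^sub>R tensor_apply m P x + ((1 - \<alpha>) / (1 + \<gamma>)) *\<^sub>R v + (\<gamma> / (1 + \<gamma>)) *\<^sub>R x"

lemma shifted_map_stochastic:
  fixes P :: "'n::finite tensor"
  assumes "m \<ge> 1" "stochastic_tensor m P" "stochastic_vector v" "stochastic_vector x"
    and "0 \<le> \<alpha>" "\<alpha> \<le> 1" "\<gamma> \<ge> 0"
  shows "stochastic_vector (shifted_map m \<alpha> \<gamma> P v x)"
proof -
  have T: "stochastic_vector (tensor_apply m P x)"
    using assms by (intro stochastic_tensor_apply)
  have "\<alpha> / (1 + \<gamma>) + (1 - \<alpha>) / (1 + \<gamma>) + \<gamma> / (1 + \<gamma>) = 1"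
    using assms by (simp add: add_divide_distrib[symmetric])
  then show ?thesis
    using T assms
    by (simp add: stochastic_vector_def shifted_map_def sum.distrib
        sum_divide_distrib[symmetric] sum_distrib_left[symmetric])
qed

text \<open>
  Shifting only rescales the displacement \<open>F x - x\<close> of the unshifted map \<open>F\<close> by \<open>1 / (1 + \<gamma>)\<close>, so it
  does not move the zeros of the displacement.
\<close>
lemma shifted_map_fixed_point_iff:
  assumes "\<gamma> \<ge> 0"
  shows "shifted_map m \<alpha> \<gamma> P v x = x \<longleftrightarrow> x = \<alpha> *\<^sub>R tensor_apply m P x + (1 - \<alpha>) *\<^sub>R v"
proof -
  define c where "c = 1 / (1 + \<gamma>)"
  have c: "c \<noteq> 0" "\<gamma> / (1 + \<gamma>) = 1 - c" "\<alpha> / (1 + \<gamma>) = c * \<alpha>" "(1 - \<alpha>) / (1 + \<gamma>) = c * (1 - \<alpha>)"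
    using assms by (simp_all add: c_def field_simps)
  have "shifted_map m \<alpha> \<gamma> P v x - x = c *\<^sub>R (\<alpha> *\<^sub>R tensor_apply m P x + (1 - \<alpha>) *\<^sub>R v - x)"
    by (simp add: shifted_map_def c algebra_simps)
  then have "shifted_map m \<alpha> \<gamma> P v x - x = 0
      \<longleftrightarrow> \<alpha> *\<^sub>R tensor_apply m P x + (1 - \<alpha>) *\<^sub>R v - x = 0"
    using c(1) by (metis scaleR_eq_0_iff)
  then show ?thesis
    by (metis right_minus_eq)
qed

lemma shifted_map_Lipschitz:
  fixes P :: "'n::finite tensor"
  assumes "m \<ge> 1" "stochastic_tensor m P" "stochastic_vector x" "stochastic_vector y"
    and "0 \<le> \<alpha>" "\<gamma> \<ge> 0"
  shows "l1_norm (shifted_map m \<alpha> \<gamma> P v x - shifted_map m \<alpha> \<gamma> P v y)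
           \<le> ((\<alpha> * (real m - 1) + \<gamma>) / (1 + \<gamma>)) * l1_norm (x - y)"
proof -
  let ?T = "tensor_apply m P x - tensor_apply m P y"
  have "shifted_map m \<alpha> \<gamma> P v x - shifted_map m \<alpha> \<gamma> P v y
      = (\<alpha> / (1 + \<gamma>)) *\<^sub>R ?T + (\<gamma> / (1 + \<gamma>)) *\<^sub>R (x - y)"
    by (simp add: shifted_map_def algebra_simps)
  then have "l1_norm (shifted_map m \<alpha> \<gamma> P v x - shifted_map m \<alpha> \<gamma> P v y)
      \<le> (\<alpha> / (1 + \<gamma>)) * l1_norm ?T + (\<gamma> / (1 + \<gamma>)) * l1_norm (x - y)"
    using l1_norm_triangle[of "(\<alpha> / (1 + \<gamma>)) *\<^sub>R ?T" "(\<gamma> / (1 + \<gamma>)) *\<^sub>R (x - y)"] assms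
    by (simp add: l1_norm_scaleR)
  also have "\<dots> \<le> (\<alpha> / (1 + \<gamma>)) * ((real m - 1) * l1_norm (x - y)) + (\<gamma> / (1 + \<gamma>)) * l1_norm (x - y)"
    using assms by (intro add_right_mono mult_left_mono l1_norm_tensor_apply_diff_le) auto
  also have "\<dots> = ((\<alpha> * (real m - 1) + \<gamma>) / (1 + \<gamma>)) * l1_norm (x - y)"
    by (simp add: add_divide_distrib distrib_right)
  finally show ?thesis .
qed

section \<open>Solutions of the multilinear PageRank problem\<close>

text \<open>
  Existence holds for every \<open>\<alpha>\<close> in \<open>[0, 1]\<close>, because the unshifted map, the case \<open>\<gamma> = 0\<close>, is a
  continuous self-map of the simplex.
\<close>
lemma multilinear_pagerank_solution_exists:
  fixes P :: "'n::finite tensor"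
  assumes "m \<ge> 1" "stochastic_tensor m P" "stochastic_vector v" "0 \<le> \<alpha>" "\<alpha> \<le> 1"
  shows "\<exists>x. multilinear_pagerank_solution m \<alpha> P v x"
proof -
  let ?S = "{x :: real ^ 'n. stochastic_vector x}"
  have "continuous_on ?S (shifted_map m \<alpha> 0 P v)"
    unfolding shifted_map_def by (intro continuous_intros continuous_on_tensor_apply)
  moreover have "shifted_map m \<alpha> 0 P v \<in> ?S \<rightarrow> ?S"
    using assms shifted_map_stochastic[of m P v _ \<alpha> 0] by auto
  moreover have "?S \<noteq> {}"
    using assms by blast
  ultimately obtain x where "x \<in> ?S" "shifted_map m \<alpha> 0 P v x = x"
    using brouwer[OF compact_stochastic convex_stochastic] by blast
  then show ?thesis
    using shifted_map_fixed_point_iff[of 0 m \<alpha> P v x]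
    by (auto simp: multilinear_pagerank_solution_def)
qed

lemma multilinear_pagerank_solution_unique:
  fixes P :: "'n::finite tensor"
  assumes "m \<ge> 1" "stochastic_tensor m P" "0 \<le> \<alpha>" "\<alpha> * (real m - 1) < 1"
    and x: "multilinear_pagerank_solution m \<alpha> P v x"
    and y: "multilinear_pagerank_solution m \<alpha> P v y"
  shows "x = y"
proof -
  have "shifted_map m \<alpha> 0 P v x = x" "shifted_map m \<alpha> 0 P v y = y"
    using x y shifted_map_fixed_point_iff[of 0 m \<alpha> P v]
    by (auto simp: multilinear_pagerank_solution_def)
  then have "l1_norm (x - y) \<le> \<alpha> * (real m - 1) * l1_norm (x - y)"
    using shifted_map_Lipschitz[of m P x y \<alpha> 0 v] assms
    by (simp add: multilinear_pagerank_solution_def)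
  then have "(1 - \<alpha> * (real m - 1)) * l1_norm (x - y) \<le> 0"
    by (simp add: algebra_simps)
  then have "l1_norm (x - y) = 0"
    using assms(4) l1_norm_nonneg[of "x - y"] by (simp add: mult_le_0_iff)
  then show ?thesis
    by (simp add: l1_norm_eq_0_iff)
qed

theorem theorem5p2:
  fixes m :: nat
    and P :: "'n::finite tensor"
    and v :: "real ^ 'n"
    and xs :: "nat \<Rightarrow> real ^ 'n"
    and \<alpha> \<gamma> :: real
  assumes "m \<ge> 2"
    and "stochastic_tensor m P"
    and "stochastic_vector v"
    and "stochastic_vector (xs 0)"
    and "0 \<le> \<alpha>" and "\<alpha> < 1 / (real m - 1)"
    and "\<gamma> \<ge> 0"
    and "\<And>k. xs (Suc k) =
           (\<alpha> / (1 + \<gamma>)) *\<^sub>R tensor_apply m P (xs k)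
           + ((1 - \<alpha>) / (1 + \<gamma>)) *\<^sub>R v
           + (\<gamma> / (1 + \<gamma>)) *\<^sub>R xs k"
  shows "(\<exists>!x. multilinear_pagerank_solution m \<alpha> P v x) \<and>
    (\<forall>x. multilinear_pagerank_solution m \<alpha> P v x \<longrightarrow>
       xs \<longlonglongrightarrow> x \<and>
       (\<forall>k. l1_norm (xs k - x) \<le> ((\<alpha> * (real m - 1) + \<gamma>) / (1 + \<gamma>)) ^ k * l1_norm (xs 0 - x) \<and>
            ((\<alpha> * (real m - 1) + \<gamma>) / (1 + \<gamma>)) ^ k * l1_norm (xs 0 - x)
              \<le> 2 * ((\<alpha> * (real m - 1) + \<gamma>) / (1 + \<gamma>)) ^ k))"
proof -
  let ?q = "(\<alpha> * (real m - 1) + \<gamma>) / (1 + \<gamma>)"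
  have m: "m \<ge> 1" "real m - 1 \<ge> 1"
    using assms(1) by auto
  have \<alpha>m: "\<alpha> * (real m - 1) < 1"
    using assms(6) m by (simp add: field_simps)
  have "1 / (real m - 1) \<le> 1"
    using m by simp
  then have \<alpha>: "\<alpha> \<le> 1"
    using assms(6) by linarith
  have q: "0 \<le> ?q" "?q < 1"
    using assms(5,7) m \<alpha>m by (auto simp: divide_simps intro!: add_nonneg_nonneg mult_nonneg_nonneg)
  have step: "xs (Suc k) = shifted_map m \<alpha> \<gamma> P v (xs k)" for k
    by (simp add: shifted_map_def assms(8))
  have stoch: "stochastic_vector (xs k)" for k
    by (induction k)
      (use assms(2-5,7) m \<alpha> in \<open>simp_all add: step shifted_map_stochastic\<close>)
  have ex1: "\<exists>!x. multilinear_pagerank_solution m \<alpha> P v x"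
    using multilinear_pagerank_solution_exists[OF m(1) assms(2,3,5) \<alpha>]
      multilinear_pagerank_solution_unique[OF m(1) assms(2,5) \<alpha>m] by blast
  have "xs \<longlonglongrightarrow> x \<and> (\<forall>k. l1_norm (xs k - x) \<le> ?q ^ k * l1_norm (xs 0 - x) \<and>
      ?q ^ k * l1_norm (xs 0 - x) \<le> 2 * ?q ^ k)"
    if sol: "multilinear_pagerank_solution m \<alpha> P v x" for x
  proof -
    have x: "stochastic_vector x" and fix_x: "shifted_map m \<alpha> \<gamma> P v x = x"
      using sol shifted_map_fixed_point_iff[OF assms(7), of m \<alpha> P v x]
      by (auto simp: multilinear_pagerank_solution_def)
    have rate: "l1_norm (xs k - x) \<le> ?q ^ k * l1_norm (xs 0 - x)" for k
    proof (induction k)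
      case 0
      then show ?case by simp
    next
      case (Suc k)
      have "l1_norm (xs (Suc k) - x) \<le> ?q * l1_norm (xs k - x)"
        using shifted_map_Lipschitz[OF m(1) assms(2) stoch[of k] x assms(5,7), of v]
        unfolding step fix_x .
      also have "\<dots> \<le> ?q * (?q ^ k * l1_norm (xs 0 - x))"
        using Suc q(1) by (rule mult_left_mono)
      finally show ?case
        by (simp only: power_Suc mult.assoc)
    qed
    have "(\<lambda>k. ?q ^ k * l1_norm (xs 0 - x)) \<longlonglongrightarrow> 0"
      by (rule tendsto_mult_left_zero[OF LIMSEQ_realpow_zero[OF q]])
    then have "(\<lambda>k. xs k - x) \<longlonglongrightarrow> 0"
      by (rule Lim_null_comparison[rotated])
        (intro always_eventually allI order.trans[OF norm_le_l1_norm rate])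
    then have "xs \<longlonglongrightarrow> x"
      by (simp add: LIM_zero_iff)
    moreover have "?q ^ k * l1_norm (xs 0 - x) \<le> 2 * ?q ^ k" for k
      using mult_left_mono[OF l1_norm_stochastic_diff_le[OF assms(4) x] zero_le_power[OF q(1)], of k]
      by (simp only: mult.commute)
    ultimately show ?thesis
      using rate by blast
  qed
  with ex1 show ?thesis
    by blast
qed

end
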